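(* Let $p>3$ be a prime and let $(a_n)_{n\ge0}$ be any sequence of $p$-adic integers, with dual sequence $a_n^*:=\sum_{k=0}^n\binom nk(-1)^ka_k$. Then $$\sum_{k=0}^{p-1}\frac{\binom{3k}k\binom{2k}k}{27^k}a_k\equiv\left(\frac p3\right)\sum_{k=0}^{p-1}\frac{\binom{3k}k\binom{2k}k}{27^k}a_k^*\pmod{p^2},$$ $$\sum_{k=0}^{p-1}\frac{\binom{4k}{2k}\binom{2k}k}{64^k}a_k\equiv\left(\frac {-2}p\right)\sum_{k=0}^{p-1}\frac{\binom{4k}{2k}\binom{2k}k}{64^k}a_k^*\pmod{p^2},$$ $$\sum_{k=0}^{p-1}\frac{\binom{6k}{3k}\binom{3k}k}{432^k}a_k\equiv\left(\frac {-1}p\right)\sum_{k=0}^{p-1}\frac{\binom{6k}{3k}\binom{3k}k}{432^k}a_k^*\pmod{p^2}.$$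
   Context: $\left(\frac{\cdot}{p}\right)$ is the Legendre symbol and $\left(\frac{p}{3}\right)$ is the Legendre symbol modulo $3$. Congruences modulo $p^2$ are taken in the ring $\mathbb Z_p$ of $p$-adic integers. *)

theory Defs
  imports "HOL-Number_Theory.Residues" "HOL-Algebra.Ideal"
begin

text \<open>
  The ring of \<open>p\<close>-adic integers as the inverse limit of the rings \<open>\<int>/p\<^sup>n\<int>\<close>: an element is a
  compatible sequence whose \<open>n\<close>-th entry is the canonical representative modulo \<open>p\<^sup>n\<close>.
  For \<open>n = 0\<close> the only residue is \<open>0\<close>, hence the reduction in the definition of \<open>one\<close>.
\<close>

definition padic_int :: "nat \<Rightarrow> (nat \<Rightarrow> int) ring" where
  "padic_int p =
    \<lparr>carrier = {x. \<forall>n. x n \<in> {0..<int p ^ n} \<and> x (Suc n) mod int p ^ n = x n},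
     monoid.mult = (\<lambda>x y n. (x n * y n) mod int p ^ n),
     monoid.one = (\<lambda>n. 1 mod int p ^ n),
     ring.zero = (\<lambda>n. 0),
     ring.add = (\<lambda>x y n. (x n + y n) mod int p ^ n)\<rparr>"

definition padic_of_int :: "nat \<Rightarrow> int \<Rightarrow> (nat \<Rightarrow> int)" where
  "padic_of_int p m = [m] \<cdot>\<^bsub>padic_int p\<^esub> \<one>\<^bsub>padic_int p\<^esub>"

text \<open>Meaningful only if \<open>p\<close> does not divide \<open>d\<close>, see \<open>padic_of_int_Unit\<close> below.\<close>

definition padic_frac :: "nat \<Rightarrow> int \<Rightarrow> int \<Rightarrow> (nat \<Rightarrow> int)" where
  "padic_frac p c d =
    padic_of_int p c \<otimes>\<^bsub>padic_int p\<^esub> inv\<^bsub>padic_int p\<^esub> (padic_of_int p d)"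

definition padic_cong :: "nat \<Rightarrow> int \<Rightarrow> (nat \<Rightarrow> int) \<Rightarrow> (nat \<Rightarrow> int) \<Rightarrow> bool" where
  "padic_cong p m x y \<longleftrightarrow>
    x \<ominus>\<^bsub>padic_int p\<^esub> y \<in> PIdl\<^bsub>padic_int p\<^esub> (padic_of_int p m)"

definition dual_seq :: "nat \<Rightarrow> (nat \<Rightarrow> (nat \<Rightarrow> int)) \<Rightarrow> nat \<Rightarrow> (nat \<Rightarrow> int)" where
  "dual_seq p a n =
    (\<Oplus>\<^bsub>padic_int p\<^esub> k \<in> {0..n}.
      padic_of_int p (int (n choose k) * (-1) ^ k) \<otimes>\<^bsub>padic_int p\<^esub> a k)"

lemma padic_compat:
  assumes "x \<in> carrier (padic_int p)"
  shows "x (Suc n) mod int p ^ n = x n" "x n mod int p ^ n = x n" "0 \<le> x n" "x n < int p ^ n"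
  using assms by (auto simp: padic_int_def)

lemma mod_power_Suc_mod: "(m mod (int p ^ Suc n)) mod int p ^ n = m mod int p ^ n"
  by (simp add: mod_mod_cancel)

lemma padic_carrierI:
  assumes "p > 0" "\<And>n. f n mod int p ^ n = f n" "\<And>n. f (Suc n) mod int p ^ n = f n"
  shows "f \<in> carrier (padic_int p)"
  using assms unfolding padic_int_def
  by (auto) (metis pos_mod_sign of_nat_0_less_iff zero_less_power,
             metis pos_mod_bound of_nat_0_less_iff zero_less_power)

lemma padic_add_closed:
  assumes "p > 0" "x \<in> carrier (padic_int p)" "y \<in> carrier (padic_int p)"
  shows "(\<lambda>n. (x n + y n) mod int p ^ n) \<in> carrier (padic_int p)"
proof (rule padic_carrierI)
  fix n
  show "(x (Suc n) + y (Suc n)) mod int p ^ Suc n mod int p ^ n = (x n + y n) mod int p ^ n"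
    unfolding mod_power_Suc_mod using assms by (metis mod_add_eq padic_compat(1))
qed (use assms in auto)

lemma padic_mult_closed:
  assumes "p > 0" "x \<in> carrier (padic_int p)" "y \<in> carrier (padic_int p)"
  shows "(\<lambda>n. (x n * y n) mod int p ^ n) \<in> carrier (padic_int p)"
proof (rule padic_carrierI)
  fix n
  show "(x (Suc n) * y (Suc n)) mod int p ^ Suc n mod int p ^ n = (x n * y n) mod int p ^ n"
    unfolding mod_power_Suc_mod using assms by (metis mod_mult_eq padic_compat(1))
qed (use assms in auto)

lemma padic_const_closed:
  assumes "p > 0"
  shows "(\<lambda>n. m mod int p ^ n) \<in> carrier (padic_int p)"
  by (rule padic_carrierI) (use assms in \<open>auto simp del: power_Suc simp: mod_power_Suc_mod\<close>)

lemma padic_uminus_closed: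
  assumes "p > 0" "x \<in> carrier (padic_int p)"
  shows "(\<lambda>n. (- x n) mod int p ^ n) \<in> carrier (padic_int p)"
proof (rule padic_carrierI)
  fix n
  show "(- x (Suc n)) mod int p ^ Suc n mod int p ^ n = (- x n) mod int p ^ n"
    unfolding mod_power_Suc_mod using assms by (metis mod_minus_eq padic_compat(1))
qed (use assms in auto)

lemma padic_int_sel:
  "monoid.mult (padic_int p) x y = (\<lambda>n. (x n * y n) mod int p ^ n)"
  "ring.add (padic_int p) x y = (\<lambda>n. (x n + y n) mod int p ^ n)"
  "monoid.one (padic_int p) = (\<lambda>n. 1 mod int p ^ n)"
  "ring.zero (padic_int p) = (\<lambda>n. 0)"
  by (simp_all add: padic_int_def)

lemma cring_padic_int:
  assumes "p > 0"
  shows "cring (padic_int p)"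
proof (rule cringI)
  show "abelian_group (padic_int p)"
  proof (rule abelian_groupI)
    fix x assume x: "x \<in> carrier (padic_int p)"
    show "\<exists>y\<in>carrier (padic_int p). y \<oplus>\<^bsub>padic_int p\<^esub> x = \<zero>\<^bsub>padic_int p\<^esub>"
      by (rule bexI[OF _ padic_uminus_closed[OF assms x]]) (simp add: padic_int_sel mod_simps)
    show "\<zero>\<^bsub>padic_int p\<^esub> \<oplus>\<^bsub>padic_int p\<^esub> x = x"
      using padic_compat(2)[OF x] by (simp add: padic_int_sel)
  next
    show "\<zero>\<^bsub>padic_int p\<^esub> \<in> carrier (padic_int p)"
      using padic_const_closed[OF assms, of 0] by (simp add: padic_int_sel)
  qed (auto simp: padic_int_sel padic_add_closed assms mod_simps algebra_simps)
  show "comm_monoid (padic_int p)"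
  proof (rule comm_monoidI)
    fix x assume x: "x \<in> carrier (padic_int p)"
    show "\<one>\<^bsub>padic_int p\<^esub> \<otimes>\<^bsub>padic_int p\<^esub> x = x"
      using padic_compat(2)[OF x] by (simp add: padic_int_sel mod_simps)
  qed (auto simp: padic_int_sel padic_mult_closed padic_const_closed assms mod_simps algebra_simps)
qed (auto simp: padic_int_sel mod_simps algebra_simps)

lemma padic_of_int_eq:
  assumes "p > 0"
  shows "padic_of_int p m = (\<lambda>n. m mod int p ^ n)"
proof -
  interpret cring "padic_int p" by (rule cring_padic_int[OF assms])
  have nat: "[k] \<cdot>\<^bsub>padic_int p\<^esub> \<one>\<^bsub>padic_int p\<^esub> = (\<lambda>n. int k mod int p ^ n)" for k :: nat
    by (induction k) (auto simp: padic_int_sel mod_simps algebra_simps)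
  have neg: "\<ominus>\<^bsub>padic_int p\<^esub> (\<lambda>n. k mod int p ^ n) = (\<lambda>n. (- k) mod int p ^ n)" for k
  proof (rule minus_equality)
    show "(\<lambda>n. - k mod int p ^ n) \<oplus>\<^bsub>padic_int p\<^esub> (\<lambda>n. k mod int p ^ n) = \<zero>\<^bsub>padic_int p\<^esub>"
      by (simp add: padic_int_sel mod_simps)
  qed (use padic_const_closed[OF assms] in auto)
  show ?thesis
  proof (cases "m \<ge> 0")
    case True
    then obtain k where "m = int k" using nonneg_int_cases by blast
    then show ?thesis using nat[of k] by (simp add: padic_of_int_def add_pow_int_ge)
  next
    case False
    then obtain k where k: "m = - int k" "m < 0" using nonpos_int_cases by (metis linorder_not_le nle_le)
    then show ?thesis using nat[of k] neg[of "int k"]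
      by (simp add: padic_of_int_def add_pow_int_lt)
  qed
qed

lemma padic_of_int_Unit:
  assumes "prime p" "coprime d (int p)"
  shows "padic_of_int p d \<in> Units (padic_int p)"
proof -
  have p: "p > 0" using assms(1) by (rule prime_gt_0_nat)
  interpret cring "padic_int p" by (rule cring_padic_int[OF p])
  have "\<exists>z. [d * z = 1] (mod int p ^ n)" for n
    by (rule cong_solve_coprime_int) (use assms(2) in simp)
  then obtain z where z: "\<And>n. [d * z n = 1] (mod int p ^ n)" by metis
  define y where "y n = z n mod int p ^ n" for n
  have y: "[d * y n = 1] (mod int p ^ n)" for n
    using z[of n] by (simp add: y_def cong_def mod_simps)
  have "y \<in> carrier (padic_int p)"
  proof (rule padic_carrierI[OF p])
    fix n
    have "[d * y (Suc n) = 1] (mod int p ^ n)"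
      using y[of "Suc n"] by (rule cong_dvd_modulus) simp
    then have "[d * y (Suc n) = d * y n] (mod int p ^ n)"
      using y[of n] cong_sym cong_trans by blast
    then have "[y (Suc n) = y n] (mod int p ^ n)"
      using assms(2) by (simp add: cong_mult_lcancel)
    then show "y (Suc n) mod int p ^ n = y n"
      by (simp add: cong_def y_def)
  qed (simp add: y_def)
  moreover have "padic_of_int p d \<otimes>\<^bsub>padic_int p\<^esub> y = \<one>\<^bsub>padic_int p\<^esub>"
    using y by (auto simp: padic_of_int_eq[OF p] padic_int_sel cong_def mod_simps)
  moreover have "padic_of_int p d \<in> carrier (padic_int p)"
    using padic_const_closed[OF p] by (simp add: padic_of_int_eq[OF p])
  ultimately show ?thesis
    unfolding Units_def using m_comm by auto
qed

end

theory Submission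
  imports Defs "HOL-Number_Theory.Gauss" "HOL-Computational_Algebra.Polynomial"
begin

text \<open>
  For \<open>x = -1/3, -1/4, -1/6\<close> the weights in the three sums are \<open>w\<^sub>k(x) = binom(x, k) binom(-1-x, k)\<close>.
  Comparing the coefficients of \<open>a\<^sub>j\<close>, one has to show that
  \<open>F(x) = \<Sum>\<^sub>k (-1)\<^sup>j binom(k, j) w\<^sub>k(x) - (-1)\<^sup>n w\<^sub>j(x)\<close> vanishes modulo \<open>p\<^sup>2\<close>, where \<open>n\<close> is the least
  residue of \<open>x\<close> modulo \<open>p\<close>. By a binomial identity, \<open>F\<close> vanishes at the natural numbers \<open>n\<close>
  and \<open>p - 1 - n\<close>, which have the same parity. Since \<open>F\<close> is invariant under \<open>x \<mapsto> -1 - x\<close>, it also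
  vanishes at \<open>n - p\<close>. Modulo \<open>p\<^sup>2\<close> the map \<open>t \<mapsto> F(n + p t)\<close> is affine, and it vanishes at
  \<open>t = 0\<close> and \<open>t = -1\<close>, hence identically. Finally, \<open>(-1)\<^sup>n\<close> is the Legendre symbol in question.
\<close>

section \<open>The binomial identity that makes F vanish at natural numbers\<close>

text \<open>Up to sign, the left side is the m-th finite difference of binom(N, n) in N, and each
  difference lowers the bottom index by one. In the induction, Pascal's rule on
  \<open>Suc m choose i\<close> splits the sum into those for N and N + 1, so N has to stay
  arbitrary.\<close>

lemma alternating_sum_binomial_shift:
  assumes "m \<le> n"
  shows "(\<Sum>i\<le>m. (-1) ^ i * int (m choose i) * int ((N + i) choose n)) =
    (-1) ^ m * int (N choose (n - m))"
  using assms
proof (induction m arbitrary: N)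
  case 0
  then show ?case by simp
next
  case (Suc m)
  let ?g = "\<lambda>N i. (-1) ^ i * int (m choose i) * int ((N + i) choose n)"
  have "(\<Sum>i\<le>Suc m. (-1) ^ i * int (Suc m choose i) * int ((N + i) choose n)) =
      int (N choose n) + (\<Sum>i\<le>m. (-1) ^ Suc i * int (m choose Suc i) * int ((N + Suc i) choose n))
      - (\<Sum>i\<le>m. ?g (Suc N) i)"
    unfolding sum.atMost_Suc_shift
    by (simp add: algebra_simps sum.distrib sum_negf sum_subtractf)
  also have "int (N choose n) + (\<Sum>i\<le>m. (-1) ^ Suc i * int (m choose Suc i) * int ((N + Suc i) choose n))
      = (\<Sum>i\<le>Suc m. ?g N i)"
    unfolding sum.atMost_Suc_shift by simp
  also have "\<dots> = (\<Sum>i\<le>m. ?g N i)"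
    by simp
  finally have "(\<Sum>i\<le>Suc m. (-1) ^ i * int (Suc m choose i) * int ((N + i) choose n)) =
      (-1) ^ m * (int (N choose (n - m)) - int (Suc N choose (n - m)))"
    using Suc.prems by (simp only: Suc.IH[of N] Suc.IH[of "Suc N"]) (simp add: algebra_simps Suc)
  also have "n - m = Suc (n - Suc m)"
    using Suc.prems by simp
  finally show ?case
    by simp
qed

text \<open>The numbers (-1)^k binom(n, k) binom(n + k, k) are the coefficients of the Legendre
  polynomial P_n(1 - 2x). Expanding at x + 1, the identity is the parity P_n(-y) = (-1)^n P_n(y),
  read off at x^j. The proof is direct: binom(n, k) binom(k, j) = binom(n, j) binom(n - j, k - j)
  turns the sum into an (n - j)-th difference.\<close>

lemma sum_choose_Legendre_coeff:
  assumes "n < q"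
  shows "(\<Sum>k<q. (-1) ^ k * int (n choose k) * int ((n + k) choose k) * int (k choose j)) =
    (-1) ^ n * int (n choose j) * int ((n + j) choose j)"
proof (cases "j \<le> n")
  case True
  let ?f = "\<lambda>k. (-1) ^ k * int (n choose k) * int ((n + k) choose k) * int (k choose j)"
  have "(\<Sum>k<q. ?f k) = (\<Sum>k\<in>{j..n}. ?f k)"
    using assms by (intro sum.mono_neutral_right) (auto simp: not_le)
  also have "\<dots> = (\<Sum>i\<in>{0..n - j}. ?f (i + j))"
    using True sum.shift_bounds_cl_nat_ivl[of ?f 0 j "n - j"] by simp
  also have "\<dots> = (\<Sum>i\<in>{0..n - j}. (-1) ^ j * int (n choose j) *
      ((-1) ^ i * int ((n - j) choose i) * int ((n + j + i) choose n)))"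
  proof (rule sum.cong)
    fix i assume i: "i \<in> {0..n - j}"
    have 1: "(n choose (i + j)) * ((i + j) choose j) = (n choose j) * ((n - j) choose i)"
      using True i choose_mult[of j "i + j" n] by simp
    have 2: "(n + (i + j)) choose (i + j) = (n + j + i) choose n"
      using binomial_symmetric[of n "n + j + i"] by (simp add: ac_simps)
    have "int (n choose (i + j)) * int ((i + j) choose j) = int (n choose j) * int ((n - j) choose i)"
      using 1 by (metis of_nat_mult)
    then show "?f (i + j) = (-1) ^ j * int (n choose j) *
      ((-1) ^ i * int ((n - j) choose i) * int ((n + j + i) choose n))"
      unfolding 2 by (simp add: power_add ac_simps)
  qed simp
  also have "\<dots> = (-1) ^ j * int (n choose j) * ((-1) ^ (n - j) * int ((n + j) choose j))"
    using alternating_sum_binomial_shift[of "n - j" n "n + j"] True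
    by (simp add: atMost_atLeast0 flip: sum_distrib_left)
  also have "\<dots> = (-1) ^ (j + (n - j)) * int (n choose j) * int ((n + j) choose j)"
    by (simp only: power_add) (simp add: ac_simps)
  finally show ?thesis
    using True by simp
next
  case False
  then have "n < k \<or> k < j" for k
    by linarith
  with False show ?thesis
    by (auto intro!: sum.neutral simp: binomial_eq_0)
qed

section \<open>Products of generalised binomial coefficients\<close>

text \<open>This is \<open>k!\<^sup>2\<close> times the product of the generalised binomial coefficients
  \<open>x\<close> over \<open>k\<close> and \<open>-1 - x\<close> over \<open>k\<close>.\<close>

definition binom_num :: "nat \<Rightarrow> 'a::comm_ring_1 \<Rightarrow> 'a" where
  "binom_num k x = (\<Prod>i<k. (x - of_nat i) * (- 1 - x - of_nat i))"

lemma binom_num_reflect: "binom_num k (- 1 - x) = binom_num k x"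
  unfolding binom_num_def by (rule prod.cong) (simp_all add: algebra_simps)

lemma poly_binom_num: "poly (binom_num k [:0, 1:]) x = binom_num k x"
  by (simp add: binom_num_def poly_prod flip: of_nat_poly)

text \<open>Upper negation gives binom(-1 - n, k) = (-1)^k binom(n + k, k), so at a natural number
  the weight becomes a Legendre coefficient.\<close>

lemma binom_num_of_nat:
  "binom_num k (int n) = (-1) ^ k * (fact k)\<^sup>2 * int (n choose k) * int ((n + k) choose k)"
proof (induction k)
  case 0
  then show ?case by (simp add: binom_num_def)
next
  case (Suc k)
  have 1: "int (n choose k) * (int n - int k) = int (Suc k) * int (n choose Suc k)"
  proof (cases "k \<le> n")
    case True
    have "Suc k * (n choose Suc k) = (n - k) * (n choose k)"
      by (metis binomial_absorb_comp binomial_absorption)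
    then show ?thesis
      using True by (metis mult.commute of_nat_diff of_nat_mult)
  qed (simp add: not_le binomial_eq_0)
  have 2: "int ((n + k) choose k) * (int n + int k + 1) = int (Suc k) * int ((n + Suc k) choose Suc k)"
    using arg_cong[OF Suc_times_binomial_eq[of "n + k" k], of int]
    by (simp add: algebra_simps del: binomial_Suc_Suc)
  have "binom_num (Suc k) (int n) = - ((-1) ^ k * (fact k)\<^sup>2 *
     (int (n choose k) * (int n - int k)) * (int ((n + k) choose k) * (int n + int k + 1)))"
    using Suc by (simp add: binom_num_def algebra_simps)
  also have "\<dots> = (-1) ^ Suc k * (int (Suc k) * fact k)\<^sup>2 * int (n choose Suc k) * int ((n + Suc k) choose Suc k)"
    unfolding 1 2 by (simp only: power_mult_distrib power_Suc) (simp add: power2_eq_square del: of_nat_Suc)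
  finally show ?case
    by (simp add: algebra_simps)
qed

section \<open>Vanishing of F modulo p^2\<close>

text \<open>A first-order Taylor expansion: \<open>d\<close> plays the role of the derivative at
  \<open>n\<close>, and all later terms contain \<open>q\<^sup>2\<close>. What matters is that
  \<open>d\<close> does not depend on \<open>t\<close>.\<close>

lemma poly_cong_square:
  fixes P :: "int poly"
  obtains d where "\<And>t. [poly P (n + q * t) = poly P n + q * t * d] (mod q\<^sup>2)"
proof -
  have "\<exists>d. \<forall>t. [poly P (n + q * t) = poly P n + q * t * d] (mod q\<^sup>2)"
  proof (induction P)
    case 0
    then show ?case by (auto intro: exI[of _ 0])
  next
    case (pCons a P)
    then obtain d where d: "\<And>t. [poly P (n + q * t) = poly P n + q * t * d] (mod q\<^sup>2)"
      by blast
    \<comment> \<open>The new slope is the product rule for a + x P(x).\<close>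
    have "[poly (pCons a P) (n + q * t) = poly (pCons a P) n + q * t * (poly P n + n * d)] (mod q\<^sup>2)" for t
    proof -
      have "[a + (n + q * t) * poly P (n + q * t) = a + (n + q * t) * (poly P n + q * t * d)] (mod q\<^sup>2)"
        by (intro cong_add cong_mult d) auto
      also have "a + (n + q * t) * (poly P n + q * t * d) =
          a + n * poly P n + q * t * (poly P n + n * d) + q\<^sup>2 * (t\<^sup>2 * d)"
        by (simp add: algebra_simps power2_eq_square)
      also have "[\<dots> = a + n * poly P n + q * t * (poly P n + n * d)] (mod q\<^sup>2)"
        by (simp add: cong_iff_dvd_diff)
      finally show ?thesis by simp
    qed
    then show ?case by blast
  qed
  with that show ?thesis by blast
qed

lemma coprime_fact_prime:
  assumes "prime p" "k < p"
  shows "coprime (fact k :: int) (int p)"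
proof -
  have "\<not> p dvd fact k"
    using assms prime_dvd_fact_iff by (metis not_le)
  then have "coprime p (fact k)"
    using assms(1) by (simp add: prime_imp_coprime)
  then show ?thesis
    by (metis coprime_commute coprime_int_iff of_nat_fact)
qed

text \<open>The congruence F(x) = 0 at x = n + p t. The numbers \<open>c k\<close> stand for w_k(x)
  modulo p^2; the hypothesis on them is cleared of the denominator k!^2 to stay within the
  integers.\<close>

lemma sum_choose_binom_num_cong:
  fixes t :: int and c :: "nat \<Rightarrow> int"
  assumes "prime p" "odd p" "n < p" "j < p"
    and c: "\<And>k. k < p \<Longrightarrow> [c k * (fact k)\<^sup>2 = binom_num k (int n + int p * t)] (mod (int p)\<^sup>2)"
  shows "[(\<Sum>k<p. c k * int (k choose j)) * (-1) ^ j = (-1) ^ n * c j] (mod (int p)\<^sup>2)"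
proof -
  have cop: "coprime ((fact k)\<^sup>2 :: int) ((int p)\<^sup>2)" if "k < p" for k
    using coprime_fact_prime[OF assms(1) that] by simp
  have "\<exists>e. [(fact k)\<^sup>2 * e = 1] (mod (int p)\<^sup>2)" if "k < p" for k
    by (rule cong_solve_coprime_int[OF cop[OF that]])
  then obtain e where e: "\<And>k. k < p \<Longrightarrow> [(fact k)\<^sup>2 * e k = 1] (mod (int p)\<^sup>2)"
    by metis
  \<comment> \<open>F as an integer polynomial in x: the inverse \<open>e k\<close> modulo p^2
    replaces the denominator k!^2, which is a unit because k < p.\<close>
  define P :: "int poly" where
    "P = (\<Sum>k<p. smult (e k * int (k choose j) * (-1) ^ j) (binom_num k [:0, 1:]))
       - smult ((-1) ^ n * e j) (binom_num j [:0, 1:])"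
  have P: "poly P x = (\<Sum>k<p. e k * binom_num k x * int (k choose j)) * (-1) ^ j
       - (-1) ^ n * (e j * binom_num j x)" for x
    by (simp add: P_def poly_sum poly_binom_num sum_distrib_left sum_distrib_right ac_simps)
  \<comment> \<open>At a natural number m < p, \<open>e k\<close> cancels k!^2 and the Legendre
    coefficient identity applies; equal parity of m and n matches its sign with the one in
    \<open>P\<close>.\<close>
  have root: "[poly P (int m) = 0] (mod (int p)\<^sup>2)" if m: "m < p" "(-1::int) ^ m = (-1) ^ n" for m
  proof -
    let ?l = "\<lambda>k. (-1) ^ k * int (m choose k) * int ((m + k) choose k)"
    have l: "[e k * binom_num k (int m) = ?l k] (mod (int p)\<^sup>2)" if "k < p" for k
    proof -
      have "[((fact k)\<^sup>2 * e k) * ?l k = 1 * ?l k] (mod (int p)\<^sup>2)"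
        by (intro cong_mult e that) auto
      then show ?thesis
        by (simp add: binom_num_of_nat ac_simps)
    qed
    have "[poly P (int m) = (\<Sum>k<p. ?l k * int (k choose j)) * (-1) ^ j - (-1) ^ n * ?l j] (mod (int p)\<^sup>2)"
      unfolding P by (intro cong_diff cong_mult cong_sum l assms) auto
    also have "(\<Sum>k<p. ?l k * int (k choose j)) * (-1) ^ j - (-1) ^ n * ?l j = 0"
      unfolding sum_choose_Legendre_coeff[OF m(1)] m(2) by simp
    finally show ?thesis .
  qed
  obtain d where d: "\<And>t. [poly P (int n + int p * t) = poly P (int n) + int p * t * d] (mod (int p)\<^sup>2)"
    using poly_cong_square[of P "int n" "int p"] by blast
  have 0: "[poly P (int n) = 0] (mod (int p)\<^sup>2)"
    using root[of n] assms by simp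
  \<comment> \<open>\<open>P\<close> is invariant under \<open>x \<mapsto> -1 - x\<close>, so the root \<open>p - 1 - n\<close> also yields the root \<open>n - p\<close>.\<close>
  have "[poly P (int n + int p * (-1)) = 0] (mod (int p)\<^sup>2)"
  proof -
    have "n + (p - 1 - n) = p - 1"
      using assms by simp
    then have "even (n + (p - 1 - n))"
      using assms by simp
    then have "(-1::int) ^ (p - 1 - n) = (-1) ^ n"
      by (metis even_add neg_one_even_power neg_one_odd_power)
    then have "[poly P (int (p - 1 - n)) = 0] (mod (int p)\<^sup>2)"
      using assms by (intro root) auto
    moreover have "int (p - 1 - n) = - 1 - (int n + int p * (-1))"
      using assms by simp
    ultimately show ?thesis
      unfolding P by (simp only: binom_num_reflect)
  qed
  \<comment> \<open>At t = -1 the expansion reads 0 = 0 - p d, so the linear term vanishes for every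
    t.\<close>
  with d[of "-1"] 0 have "[int p * d = 0] (mod (int p)\<^sup>2)"
    by (simp add: cong_0_iff cong_dvd_iff) (metis dvd_diff_right_iff)
  then have "[int p * d * t = 0 * t] (mod (int p)\<^sup>2)"
    by (rule cong_mult) auto
  with 0 have "[poly P (int n) + int p * t * d = 0 + 0] (mod (int p)\<^sup>2)"
    by (intro cong_add) (simp_all add: ac_simps)
  with d[of t] have "[poly P (int n + int p * t) = 0] (mod (int p)\<^sup>2)"
    using cong_trans by fastforce
  moreover have ce: "[e k * binom_num k (int n + int p * t) = c k] (mod (int p)\<^sup>2)" if "k < p" for k
  proof -
    have "[e k * binom_num k (int n + int p * t) = e k * (c k * (fact k)\<^sup>2)] (mod (int p)\<^sup>2)"
      using c[OF that] by (intro cong_mult) (auto intro: cong_sym)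
    also have "e k * (c k * (fact k)\<^sup>2) = ((fact k)\<^sup>2 * e k) * c k"
      by simp
    also have "[\<dots> = 1 * c k] (mod (int p)\<^sup>2)"
      by (intro cong_mult e that) auto
    finally show ?thesis by simp
  qed
  have "[poly P (int n + int p * t) = (\<Sum>k<p. c k * int (k choose j)) * (-1) ^ j - (-1) ^ n * c j] (mod (int p)\<^sup>2)"
    unfolding P by (intro cong_diff cong_mult cong_sum ce assms) auto
  ultimately show ?thesis
    by (metis cong_diff_iff_cong_0 cong_sym cong_trans)
qed

section \<open>Reducing p-adic congruences to integer congruences\<close>

lemma finsum_padic_int_apply:
  assumes "p > 0" "finite S" "\<And>k. k \<in> S \<Longrightarrow> f k \<in> carrier (padic_int p)"
  shows "(\<Oplus>\<^bsub>padic_int p\<^esub> k \<in> S. f k) n = (\<Sum>k\<in>S. f k n) mod int p ^ n"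
proof -
  interpret cring "padic_int p" by (rule cring_padic_int[OF assms(1)])
  show ?thesis
    using assms(2,3)
  proof (induction S)
    case empty
    then show ?case by (simp add: padic_int_sel)
  next
    case (insert k S)
    then have "(\<Oplus>\<^bsub>padic_int p\<^esub> k \<in> insert k S. f k) = f k \<oplus>\<^bsub>padic_int p\<^esub> (\<Oplus>\<^bsub>padic_int p\<^esub> k \<in> S. f k)"
      by (intro finsum_insert) auto
    with insert show ?case
      by (simp add: padic_int_sel mod_simps)
  qed
qed

text \<open>The difference has m-th entry 0, and such an element is p^m times a p-adic integer;
  membership in the principal ideal requires exhibiting this quotient.\<close>

lemma padic_congI:
  assumes "p > 0" and x: "x \<in> carrier (padic_int p)" and y: "y \<in> carrier (padic_int p)"
    and "x m = y m"
  shows "padic_cong p (int p ^ m) x y"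
proof -
  interpret cring "padic_int p" by (rule cring_padic_int[OF assms(1)])
  define z where "z = x \<ominus>\<^bsub>padic_int p\<^esub> y"
  have z: "z \<in> carrier (padic_int p)"
    using x y by (simp add: z_def)
  have "z \<oplus>\<^bsub>padic_int p\<^esub> y = x"
    using x y by (simp add: z_def minus_eq a_assoc l_neg)
  then have "(z m + y m) mod int p ^ m = y m"
    using assms(4) by (metis padic_int_sel(2))
  then have "[z m + y m = 0 + y m] (mod int p ^ m)"
    using padic_compat(2)[OF y] by (simp add: cong_def)
  then have "[z m = 0] (mod int p ^ m)"
    by (simp only: cong_add_rcancel)
  then have zm: "z m = 0"
    using padic_compat(2)[OF z] by (simp add: cong_def)
  have shift: "z (n + m) mod int p ^ m = 0" for n
  proof (induction n)
    case 0
    then show ?case by (simp add: zm)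
  next
    case (Suc n)
    then show ?case
      using padic_compat(1)[OF z, of "n + m"]
      by (metis add_Suc le_add2 le_imp_power_dvd mod_mod_cancel)
  qed
  \<comment> \<open>Dividing by p^m costs m digits of precision, so entry n of the quotient is taken
    from entry n + m of \<open>z\<close>.\<close>
  define w where "w n = z (n + m) div int p ^ m" for n
  have zw: "z (n + m) = int p ^ m * w n" for n
    using shift[of n] unfolding w_def by (simp add: mod_eq_0_iff_dvd)
  have pm: "int p ^ m \<noteq> 0"
    using assms(1) by simp
  have w: "w \<in> carrier (padic_int p)"
  proof (rule padic_carrierI[OF assms(1)])
    fix n
    have "int p ^ m * (w n mod int p ^ n) = z (n + m) mod int p ^ (n + m)"
      by (subst mult_mod_right) (simp only: zw power_add mult.commute)
    also have "\<dots> = int p ^ m * w n"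
      using padic_compat(2)[OF z, of "n + m"] zw[of n] by simp
    finally have "int p ^ m * (w n mod int p ^ n) = int p ^ m * w n" .
    with pm show "w n mod int p ^ n = w n" by (simp only: mult_cancel_left) simp
    have "int p ^ m * (w (Suc n) mod int p ^ n) = z (Suc n + m) mod int p ^ (n + m)"
      by (subst mult_mod_right) (simp only: zw power_add mult.commute)
    also have "\<dots> = int p ^ m * w n"
      using padic_compat(1)[OF z, of "n + m"] zw[of n] by simp
    finally have "int p ^ m * (w (Suc n) mod int p ^ n) = int p ^ m * w n" .
    with pm show "w (Suc n) mod int p ^ n = w n" by (simp only: mult_cancel_left) simp
  qed
  have low: "z (n + i) mod int p ^ n = z n" for n i
  proof (induction i)
    case 0
    then show ?case using padic_compat(2)[OF z] by simp
  next
    case (Suc i)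
    then show ?case
      using padic_compat(1)[OF z, of "n + i"]
      by (metis add_Suc_right le_add1 le_imp_power_dvd mod_mod_cancel)
  qed
  have "z = w \<otimes>\<^bsub>padic_int p\<^esub> padic_of_int p (int p ^ m)"
  proof
    fix n
    have "z n = (w n * int p ^ m) mod int p ^ n"
      using low[of n m] zw[of n] by (simp add: mult.commute)
    then show "z n = (w \<otimes>\<^bsub>padic_int p\<^esub> padic_of_int p (int p ^ m)) n"
      by (simp add: padic_of_int_eq[OF assms(1)] padic_int_sel mod_simps)
  qed
  then show ?thesis
    unfolding padic_cong_def cgenideal_def z_def[symmetric] using w by blast
qed

lemma padic_of_int_closed: "p > 0 \<Longrightarrow> padic_of_int p m \<in> carrier (padic_int p)"
  by (simp add: padic_of_int_eq padic_const_closed)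

lemma padic_frac_closed:
  assumes "prime p" "coprime d (int p)"
  shows "padic_frac p c d \<in> carrier (padic_int p)"
proof -
  interpret cring "padic_int p" by (rule cring_padic_int[OF prime_gt_0_nat[OF assms(1)]])
  show ?thesis
    unfolding padic_frac_def
    using padic_of_int_Unit[OF assms] padic_of_int_closed prime_gt_0_nat[OF assms(1)] by blast
qed

lemma padic_frac_cong:
  assumes "prime p" "coprime d (int p)"
  shows "[padic_frac p c d n * d = c] (mod int p ^ n)"
proof -
  have p: "p > 0" by (rule prime_gt_0_nat[OF assms(1)])
  interpret cring "padic_int p" by (rule cring_padic_int[OF p])
  have "padic_frac p c d \<otimes>\<^bsub>padic_int p\<^esub> padic_of_int p d = padic_of_int p c"
    unfolding padic_frac_def
    using padic_of_int_Unit[OF assms] padic_of_int_closed[OF p] by (simp add: m_assoc)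
  then have "(padic_frac p c d \<otimes>\<^bsub>padic_int p\<^esub> padic_of_int p d) n = padic_of_int p c n"
    by simp
  then show ?thesis
    by (simp add: padic_of_int_eq[OF p] padic_int_sel cong_def mod_simps)
qed

lemma dual_seq_closed:
  assumes "p > 0" "\<And>n. a n \<in> carrier (padic_int p)"
  shows "dual_seq p a n \<in> carrier (padic_int p)"
proof -
  interpret cring "padic_int p" by (rule cring_padic_int[OF assms(1)])
  show ?thesis
    unfolding dual_seq_def using assms padic_of_int_closed by (intro finsum_closed) auto
qed

text \<open>Since binom(n, j) = 0 for j > n, the sum can run over a range independent of n, which
  permits interchanging it with the outer sum later.\<close>

lemma dual_seq_cong:
  assumes "p > 0" "\<And>n. a n \<in> carrier (padic_int p)" "n < q"
  shows "[dual_seq p a n m = (\<Sum>j<q. int (n choose j) * (-1) ^ j * a j m)] (mod int p ^ m)"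
proof -
  interpret cring "padic_int p" by (rule cring_padic_int[OF assms(1)])
  let ?f = "\<lambda>j. int (n choose j) * (-1) ^ j * a j m"
  have "dual_seq p a n m = (\<Sum>j\<in>{0..n}. (padic_of_int p (int (n choose j) * (-1) ^ j) \<otimes>\<^bsub>padic_int p\<^esub> a j) m)
      mod int p ^ m"
    unfolding dual_seq_def using assms padic_of_int_closed by (intro finsum_padic_int_apply) auto
  also have "\<dots> = (\<Sum>j\<in>{0..n}. ?f j mod int p ^ m) mod int p ^ m"
    using assms(1) by (simp add: padic_of_int_eq padic_int_sel mod_simps)
  also have "\<dots> = (\<Sum>j\<in>{0..n}. ?f j) mod int p ^ m"
    by (rule mod_sum_eq)
  also have "(\<Sum>j\<in>{0..n}. ?f j) = (\<Sum>j<q. ?f j)"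
    using assms(3) by (intro sum.mono_neutral_left) (auto simp: not_le)
  finally show ?thesis
    by (simp add: cong_def)
qed

section \<open>The duality congruence for x = -1/m\<close>

text \<open>The common form of the three congruences. For x = -1/m each factor (x - i)(-1 - x - i)
  equals (m i + 1)(m i + m - 1) / m^2, so \<open>c\<close> says that c_k / (e m^2)^k = w_k(x). The
  pairs (e, m) are (3, 3), (4, 4) and (12, 6), with e m^2 = 27, 64 and 432. The hypothesis
  \<open>s\<close> evaluates (-1)^n for the least residue n of x.\<close>

lemma dual_sum_padic_cong:
  fixes c :: "nat \<Rightarrow> int" and e m s :: int
  assumes p: "prime p" "odd p" and a: "\<And>n. a n \<in> carrier (padic_int p)"
    and cop: "coprime (e * m\<^sup>2) (int p)"
    and c: "\<And>k. c k * (fact k)\<^sup>2 = e ^ k * (\<Prod>i<k. (m * int i + 1) * (m * int i + m - 1))"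
    and s: "\<And>n. n < p \<Longrightarrow> [m * int n = - 1] (mod int p) \<Longrightarrow> (-1) ^ n = s"
  shows "padic_cong p (int p ^ 2)
      (\<Oplus>\<^bsub>padic_int p\<^esub> k \<in> {0..p-1}. padic_frac p (c k) ((e * m\<^sup>2) ^ k) \<otimes>\<^bsub>padic_int p\<^esub> a k)
      (padic_of_int p s \<otimes>\<^bsub>padic_int p\<^esub>
        (\<Oplus>\<^bsub>padic_int p\<^esub> k \<in> {0..p-1}.
          padic_frac p (c k) ((e * m\<^sup>2) ^ k) \<otimes>\<^bsub>padic_int p\<^esub> dual_seq p a k))"
proof -
  have p0: "p > 0" by (rule prime_gt_0_nat[OF p(1)])
  interpret cring "padic_int p" by (rule cring_padic_int[OF p0])
  have copk: "coprime ((e * m\<^sup>2) ^ k) (int p)" for k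
    using cop by simp
  define f where "f k = padic_frac p (c k) ((e * m\<^sup>2) ^ k)" for k
  define C where "C k = f k 2" for k
  have f: "f k \<in> carrier (padic_int p)" for k
    unfolding f_def by (rule padic_frac_closed[OF p(1) copk])
  have ds: "dual_seq p a k \<in> carrier (padic_int p)" for k
    by (rule dual_seq_closed[OF p0 a])
  have set: "{0..p-1} = {..<p}"
    using p0 by auto
  have "coprime m ((int p)\<^sup>2)"
    using cop by simp
  then obtain y where "[m * y = 1] (mod (int p)\<^sup>2)"
    using cong_solve_coprime_int by blast
  \<comment> \<open>Modulo p^2, the integer \<open>- y\<close> represents x = -1/m; it is then split
    as n + p t with n its least residue modulo p.\<close>
  then have mx: "[m * (- y) = - 1] (mod (int p)\<^sup>2)"
    by (simp add: cong_minus_minus_iff)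
  define n where "n = nat ((- y) mod int p)"
  define t where "t = (- y) div int p"
  have x: "- y = int n + int p * t"
    using p0 by (simp add: n_def t_def)
  have n: "n < p"
    using p0 by (simp add: n_def nat_less_iff)
  have "[m * (- y) = - 1] (mod int p)"
    using mx by (rule cong_dvd_modulus) simp
  moreover have "[m * (- y) = m * int n] (mod int p)"
    by (simp add: x cong_iff_dvd_diff algebra_simps)
  ultimately have sn: "(-1) ^ n = s"
    using s[OF n] cong_sym cong_trans by blast
  \<comment> \<open>Both sides are compared after multiplication by (e m^2)^k, which is coprime to p
    and cancels at the end.\<close>
  have num: "[C k * (fact k)\<^sup>2 = binom_num k (- y)] (mod (int p)\<^sup>2)" for k
  proof -
    have "(m\<^sup>2) ^ k = (\<Prod>i<k. m\<^sup>2)"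
      by simp
    then have l: "(m\<^sup>2) ^ k * binom_num k (- y) =
        (\<Prod>i<k. (m * (- y) - m * int i) * (- m - m * (- y) - m * int i))"
      unfolding binom_num_def
      by (simp only: flip: prod.distrib) (rule prod.cong, simp_all add: algebra_simps power2_eq_square)
    have r: "(\<Prod>i<k. (m * int i + 1) * (m * int i + m - 1)) =
        (\<Prod>i<k. (- 1 - m * int i) * (- m - (- 1) - m * int i))"
      by (rule prod.cong) (simp_all add: algebra_simps)
    have 1: "[(m\<^sup>2) ^ k * binom_num k (- y) = (\<Prod>i<k. (m * int i + 1) * (m * int i + m - 1))] (mod (int p)\<^sup>2)"
      unfolding l r by (intro cong_prod cong_mult cong_diff mx) auto
    have "[C k * (e * m\<^sup>2) ^ k * (fact k)\<^sup>2 = c k * (fact k)\<^sup>2] (mod (int p)\<^sup>2)"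
      unfolding C_def f_def by (intro cong_mult padic_frac_cong p copk) auto
    also have "[c k * (fact k)\<^sup>2 = e ^ k * ((m\<^sup>2) ^ k * binom_num k (- y))] (mod (int p)\<^sup>2)"
      unfolding c by (intro cong_mult cong_sym[OF 1]) auto
    finally have "[(e * m\<^sup>2) ^ k * (C k * (fact k)\<^sup>2) = (e * m\<^sup>2) ^ k * binom_num k (- y)] (mod (int p)\<^sup>2)"
      by (simp add: power_mult_distrib ac_simps)
    moreover have "coprime ((e * m\<^sup>2) ^ k) ((int p)\<^sup>2)"
      using copk[of k] by simp
    ultimately show ?thesis
      by (simp add: cong_mult_lcancel)
  qed
  have key: "[(\<Sum>k<p. C k * int (k choose j)) * (-1) ^ j = s * C j] (mod (int p)\<^sup>2)" if "j < p" for j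
    using sum_choose_binom_num_cong[OF p n that, of C t] num sn x by simp
  have ss: "s * s = 1"
    unfolding sn[symmetric] by (simp flip: power_add)
  have "[s * (\<Sum>k<p. C k * dual_seq p a k 2) =
      s * (\<Sum>k<p. C k * (\<Sum>j<p. int (k choose j) * (-1) ^ j * a j 2))] (mod (int p)\<^sup>2)"
    by (intro cong_mult cong_sum dual_seq_cong p0 a) auto
  \<comment> \<open>Interchanging the sums isolates the coefficient of \<open>a j\<close>, to which
    \<open>key\<close> applies; the two signs then cancel by \<open>ss\<close>.\<close>
  also have "s * (\<Sum>k<p. C k * (\<Sum>j<p. int (k choose j) * (-1) ^ j * a j 2)) =
      (\<Sum>j<p. s * ((\<Sum>k<p. C k * int (k choose j)) * (-1) ^ j) * a j 2)"
    unfolding sum_distrib_left sum_distrib_right by (subst sum.swap) (simp add: ac_simps)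
  also have "[\<dots> = (\<Sum>j<p. s * (s * C j) * a j 2)] (mod (int p)\<^sup>2)"
    by (intro cong_mult cong_sum key) auto
  also have "(\<Sum>j<p. s * (s * C j) * a j 2) = (\<Sum>j<p. C j * a j 2)"
    by (simp add: ss flip: mult.assoc)
  finally have main: "[s * (\<Sum>k<p. C k * dual_seq p a k 2) = (\<Sum>k<p. C k * a k 2)] (mod (int p)\<^sup>2)" .
  \<comment> \<open>Entry 2 of a p-adic sum is its residue modulo p^2, which brings the claim down
    to \<open>main\<close>.\<close>
  have ev: "(\<Oplus>\<^bsub>padic_int p\<^esub> k \<in> {0..p-1}. f k \<otimes>\<^bsub>padic_int p\<^esub> b k) 2 = (\<Sum>k<p. C k * b k 2) mod (int p)\<^sup>2"
    if b: "\<And>k. b k \<in> carrier (padic_int p)" for b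
  proof -
    have "(\<Oplus>\<^bsub>padic_int p\<^esub> k \<in> {0..p-1}. f k \<otimes>\<^bsub>padic_int p\<^esub> b k) 2 =
        (\<Sum>k<p. (f k \<otimes>\<^bsub>padic_int p\<^esub> b k) 2) mod (int p)\<^sup>2"
      unfolding set using p0 f b by (intro finsum_padic_int_apply) auto
    then show ?thesis
      by (simp add: padic_int_sel C_def mod_sum_eq)
  qed
  show ?thesis
    unfolding f_def[symmetric]
  proof (rule padic_congI[OF p0])
    show "(\<Oplus>\<^bsub>padic_int p\<^esub> k \<in> {0..p-1}. f k \<otimes>\<^bsub>padic_int p\<^esub> a k) 2 =
      (padic_of_int p s \<otimes>\<^bsub>padic_int p\<^esub> (\<Oplus>\<^bsub>padic_int p\<^esub> k \<in> {0..p-1}. f k \<otimes>\<^bsub>padic_int p\<^esub> dual_seq p a k)) 2"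
      using main unfolding padic_int_sel(1)[of p "padic_of_int p s"] ev[OF a] ev[OF ds]
      by (simp add: padic_of_int_eq[OF p0] mod_simps cong_def)
  qed (use f a ds padic_of_int_closed[OF p0] in \<open>auto intro!: finsum_closed\<close>)
qed

section \<open>Legendre symbols of -1 and -2, and modulo 3\<close>

text \<open>Both sides lie in {-1, 0, 1}, so they differ by at most 2 < p.\<close>

lemma Legendre_eqI:
  assumes "p > 2" "s = 1 \<or> s = - 1" "[Legendre a p = s] (mod p)"
  shows "Legendre a p = s"
proof -
  have "p dvd Legendre a p - s"
    using assms(3) by (simp add: cong_iff_dvd_diff)
  moreover have "\<bar>Legendre a p - s\<bar> \<le> 2"
    using assms(2) by (auto simp: Legendre_def)
  ultimately show ?thesis
    using assms(1) zdvd_imp_le[of p "\<bar>Legendre a p - s\<bar>"] by fastforce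
qed

lemma Legendre_minus_1:
  assumes "prime p" "p > 2"
  shows "Legendre (- 1) (int p) = (-1) ^ ((p - 1) div 2)"
  using euler_criterion[OF assms, of "-1"] assms(2)
  by (intro Legendre_eqI) (auto simp: minus_one_power_iff)

text \<open>Gauss's lemma evaluates 2^h modulo p for h = (p - 1)/2; a factor (-1)^h passes to
  (-2)^h, and Euler's criterion yields the symbol.\<close>

lemma Legendre_minus_2:
  assumes "prime p" "p > 2"
  shows "Legendre (- 2) (int p) = (-1) ^ ((p - 1) div 4)"
proof -
  have odd: "odd p"
    using assms prime_odd_nat by blast
  then obtain h where h: "p = 2 * h + 1"
    by (rule oddE)
  interpret GAUSS p 2
  proof
    show "[2 \<noteq> 0] (mod int p)"
      using assms(2) by (auto simp: cong_0_iff dest: zdvd_imp_le)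
  qed (use assms in auto)
  have A: "A = {0<..int h}"
    unfolding A_def by (simp add: h)
  have "C = (\<lambda>x. x * 2) ` A"
    unfolding C_def B_def image_image
  proof (rule image_cong)
    fix x assume "x \<in> A"
    then show "x * 2 mod int p = x * 2"
      unfolding A by (simp add: h)
  qed simp
  \<comment> \<open>\<open>E\<close> collects the doubles beyond h, and 2 x > h means x > h div
    2.\<close>
  then have "E = (\<lambda>x. x * 2) ` {int (h div 2)<..int h}"
    unfolding E_def A by (auto simp: h)
  then have "card E = card {int (h div 2)<..int h}"
    by (simp add: card_image inj_on_def)
  then have E: "card E = h - h div 2"
    by simp
  have "[(2::int) ^ h = (-1) ^ (h - h div 2)] (mod int p)"
    using pre_gauss_lemma unfolding E by (simp add: h)
  then have "[(- 1) ^ h * (2::int) ^ h = (-1) ^ h * (-1) ^ (h - h div 2)] (mod int p)"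
    by (intro cong_mult) auto
  moreover have "(- 1) ^ h * (2::int) ^ h = (- 2) ^ h"
    by (simp flip: power_mult_distrib)
  \<comment> \<open>The total exponent is 2 h - h div 2, of the same parity as h div 2.\<close>
  moreover have "(-1::int) ^ h * (-1) ^ (h - h div 2) = (-1) ^ (h div 2)"
    by (auto simp: minus_one_power_iff)
  ultimately have "[(- 2::int) ^ h = (-1) ^ (h div 2)] (mod int p)"
    by simp
  moreover have "[Legendre (- 2) (int p) = (- 2) ^ h] (mod int p)"
    using euler_criterion[OF assms, of "-2"] by (simp add: h)
  ultimately have "[Legendre (- 2) (int p) = (-1) ^ (h div 2)] (mod int p)"
    using cong_trans by blast
  moreover have "(p - 1) div 4 = h div 2"
    by (simp add: h)
  ultimately show ?thesis
    using assms(2) by (intro Legendre_eqI) (auto simp: minus_one_power_iff)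
qed

lemma Legendre_mod_3:
  "Legendre a 3 = (if a mod 3 = 0 then 0 else if a mod 3 = 1 then 1 else - 1)"
proof -
  have "y\<^sup>2 mod 3 \<noteq> 2" for y :: int
  proof -
    have "y mod 3 = 0 \<or> y mod 3 = 1 \<or> y mod 3 = 2" by presburger
    moreover have "y\<^sup>2 mod 3 = (y mod 3)\<^sup>2 mod 3" by (simp add: power_mod)
    ultimately show ?thesis by auto
  qed
  moreover have "a mod 3 = 1 \<Longrightarrow> QuadRes 3 a"
    unfolding QuadRes_def by (rule exI[of _ 1]) (simp add: cong_def)
  moreover have "a mod 3 = 0 \<or> a mod 3 = 1 \<or> a mod 3 = 2" by presburger
  ultimately show ?thesis
    by (auto simp: Legendre_def QuadRes_def cong_def)
qed

section \<open>Factorial products behind the three weights\<close>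

lemma int_binomial_fact:
  assumes "k \<le> n"
  shows "fact k * fact (n - k) * int (n choose k) = fact n"
proof -
  have "int (fact k * fact (n - k) * (n choose k)) = int (fact n)"
    using binomial_fact_lemma[OF assms] by simp
  then show ?thesis
    by simp
qed

text \<open>The multiples of 3 up to 3k contribute 3^k k!; the other factors form the
  product.\<close>

lemma fact_triple:
  "(fact (3 * k) :: int) = fact k * (3 ^ k * (\<Prod>i<k. (3 * int i + 1) * (3 * int i + 3 - 1)))"
proof (induction k)
  case (Suc k)
  have "(fact (3 * Suc k) :: int) =
      (3 * int k + 3) * ((3 * int k + 2) * ((3 * int k + 1) * fact (3 * k)))"
    by (simp add: algebra_simps numeral_3_eq_3)
  then show ?case
    unfolding Suc by (simp add: algebra_simps)
qed simp

text \<open>The even factors contribute 2^(2k) (2k)!, and the odd ones form the product.\<close>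

lemma fact_quadruple:
  "(fact (4 * k) :: int) = fact (2 * k) * (4 ^ k * (\<Prod>i<k. (4 * int i + 1) * (4 * int i + 4 - 1)))"
proof (induction k)
  case (Suc k)
  have "4 * Suc k = Suc (Suc (Suc (Suc (4 * k))))"
    by simp
  then have "(fact (4 * Suc k) :: int) =
      (4 * int k + 4) * ((4 * int k + 3) * ((4 * int k + 2) * ((4 * int k + 1) * fact (4 * k))))"
    by (simp only: fact_Suc of_nat_Suc of_nat_mult of_nat_numeral) (simp add: ac_simps)
  moreover have "2 * Suc k = Suc (Suc (2 * k))"
    by simp
  then have "(fact (2 * Suc k) :: int) = (2 * int k + 2) * ((2 * int k + 1) * fact (2 * k))"
    by (simp only: fact_Suc of_nat_Suc of_nat_mult of_nat_numeral) (simp add: ac_simps)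
  ultimately show ?case
    unfolding Suc by (simp add: algebra_simps)
qed simp

text \<open>The even factors contribute 2^(3k) (3k)!, the odd multiples of 3 contribute 3^k (2k)! /
  (2^k k!), whence 12^k. The factor \<open>fact k\<close> on the left clears the
  denominator.\<close>

lemma fact_sextuple:
  "(fact (6 * k) * fact k :: int) =
    fact (3 * k) * fact (2 * k) * (12 ^ k * (\<Prod>i<k. (6 * int i + 1) * (6 * int i + 6 - 1)))"
proof (induction k)
  case (Suc k)
  let ?k = "int k"
  have "6 * Suc k = Suc (Suc (Suc (Suc (Suc (Suc (6 * k))))))"
    by simp
  then have 6: "(fact (6 * Suc k) :: int) =
      (6 * ?k + 6) * ((6 * ?k + 5) * ((6 * ?k + 4) * ((6 * ?k + 3) * ((6 * ?k + 2) * ((6 * ?k + 1) * fact (6 * k))))))"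
    by (simp only: fact_Suc of_nat_Suc of_nat_mult of_nat_numeral) (simp add: ac_simps)
  have "3 * Suc k = Suc (Suc (Suc (3 * k)))"
    by simp
  then have 3: "(fact (3 * Suc k) :: int) = (3 * ?k + 3) * ((3 * ?k + 2) * ((3 * ?k + 1) * fact (3 * k)))"
    by (simp only: fact_Suc of_nat_Suc of_nat_mult of_nat_numeral) (simp add: ac_simps)
  have "2 * Suc k = Suc (Suc (2 * k))"
    by simp
  then have 2: "(fact (2 * Suc k) :: int) = (2 * ?k + 2) * ((2 * ?k + 1) * fact (2 * k))"
    by (simp only: fact_Suc of_nat_Suc of_nat_mult of_nat_numeral) (simp add: ac_simps)
  have "(fact (6 * Suc k) * fact (Suc k) :: int) =
      (6 * ?k + 6) * (6 * ?k + 5) * (6 * ?k + 4) * (6 * ?k + 3) * (6 * ?k + 2) * (6 * ?k + 1) * (?k + 1)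
      * (fact (6 * k) * fact k)"
    unfolding 6 by (simp add: ac_simps)
  also have "(6 * ?k + 6) * (6 * ?k + 5) * (6 * ?k + 4) * (6 * ?k + 3) * (6 * ?k + 2) * (6 * ?k + 1) * (?k + 1) =
      ((3 * ?k + 3) * (3 * ?k + 2) * (3 * ?k + 1)) * ((2 * ?k + 2) * (2 * ?k + 1)) *
      (12 * ((6 * ?k + 1) * (6 * ?k + 6 - 1)))"
  proof -
    have "6 * ?k + 6 = 2 * (3 * ?k + 3)" "6 * ?k + 4 = 2 * (3 * ?k + 2)" "6 * ?k + 2 = 2 * (3 * ?k + 1)"
      "6 * ?k + 3 = 3 * (2 * ?k + 1)" "2 * ?k + 2 = 2 * (?k + 1)" "6 * ?k + 6 - 1 = 6 * ?k + 5"
      by simp_all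
    then show ?thesis
      by (simp only:) (simp only: mult_ac numeral_times_numeral[symmetric]; simp)
  qed
  finally show ?case
    unfolding Suc.IH 3 2 by (simp add: ac_simps)
qed simp

lemma binomial_3_product:
  "int (((3*k) choose k) * ((2*k) choose k)) * (fact k)\<^sup>2 =
    3 ^ k * (\<Prod>i<k. (3 * int i + 1) * (3 * int i + 3 - 1))"
proof -
  have 1: "fact k * fact (2 * k) * int ((3*k) choose k) = fact (3 * k)"
    and 2: "fact k * fact k * int ((2*k) choose k) = fact (2 * k)"
    using int_binomial_fact[of k "3 * k"] int_binomial_fact[of k "2 * k"] by simp_all
  have "fact k * (int (((3*k) choose k) * ((2*k) choose k)) * (fact k)\<^sup>2) =
      fact k * (fact k * fact k * int ((2*k) choose k)) * int ((3*k) choose k)"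
    by (simp add: power2_eq_square ac_simps)
  also have "\<dots> = fact (3 * k)"
    unfolding 1 2 ..
  finally show ?thesis
    unfolding fact_triple by simp
qed

lemma binomial_4_product:
  "int (((4*k) choose (2*k)) * ((2*k) choose k)) * (fact k)\<^sup>2 =
    4 ^ k * (\<Prod>i<k. (4 * int i + 1) * (4 * int i + 4 - 1))"
proof -
  have 1: "fact (2 * k) * fact (2 * k) * int ((4*k) choose (2*k)) = fact (4 * k)"
    and 2: "fact k * fact k * int ((2*k) choose k) = fact (2 * k)"
    using int_binomial_fact[of "2 * k" "4 * k"] int_binomial_fact[of k "2 * k"] by simp_all
  have "fact (2 * k) * (int (((4*k) choose (2*k)) * ((2*k) choose k)) * (fact k)\<^sup>2) =
      fact (2 * k) * (fact k * fact k * int ((2*k) choose k)) * int ((4*k) choose (2*k))"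
    by (simp add: power2_eq_square ac_simps)
  also have "\<dots> = fact (4 * k)"
    unfolding 1 2 ..
  finally show ?thesis
    unfolding fact_quadruple by simp
qed

lemma binomial_6_product:
  "int (((6*k) choose (3*k)) * ((3*k) choose k)) * (fact k)\<^sup>2 =
    12 ^ k * (\<Prod>i<k. (6 * int i + 1) * (6 * int i + 6 - 1))"
proof -
  have 1: "fact (3 * k) * fact (3 * k) * int ((6*k) choose (3*k)) = fact (6 * k)"
    and 2: "fact k * fact (2 * k) * int ((3*k) choose k) = fact (3 * k)"
    using int_binomial_fact[of "3 * k" "6 * k"] int_binomial_fact[of k "3 * k"] by simp_all
  have "fact (3 * k) * fact (2 * k) * (int (((6*k) choose (3*k)) * ((3*k) choose k)) * (fact k)\<^sup>2) =
      fact (3 * k) * (fact k * fact (2 * k) * int ((3*k) choose k)) * int ((6*k) choose (3*k)) * fact k"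
    by (simp add: power2_eq_square ac_simps)
  also have "\<dots> = fact (6 * k) * fact k"
    unfolding 1 2 ..
  finally show ?thesis
    unfolding fact_sextuple by simp
qed

section \<open>The sign (-1)^n and the three congruences\<close>

text \<open>The congruence \<open>m n \<equiv> -1\<close> with \<open>n < p\<close> leaves fewer than \<open>m\<close> values for the quotient
  \<open>(m n + 1) / p\<close>, so that \<open>n\<close> is determined by \<open>p\<close> modulo \<open>2 m\<close>.\<close>

lemma inverse_residue_quotient:
  assumes "n < p" "[int m * int n = - 1] (mod int p)" "m > 1"
  obtains q where "m * n + 1 = p * q" "0 < q" "q < m"
proof -
  have "int p dvd int (m * n + 1)"
    using assms(2) by (simp add: cong_iff_dvd_diff add.commute)
  then have "p dvd m * n + 1"
    by presburger
  then obtain q where q: "m * n + 1 = p * q"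
    by blast
  have "m * n + m \<le> m * p"
    using assms(1) by (metis Suc_leI mult_Suc_right mult_le_mono2 add.commute)
  then have "p * q < p * m"
    using q assms(3) by (metis add_strict_left_mono mult.commute order_less_le_trans)
  then have "q < m"
    by simp
  moreover have "0 < q"
    using q by (cases q) auto
  ultimately show ?thesis
    using that q by blast
qed

text \<open>Serves to invert 27 = 3^3, 64 = 2^6 and 432 = 2^4 3^3 in the p-adic integers.\<close>

lemma coprime_prime_3_smooth:
  assumes "prime (p::nat)" "p > 3"
  shows "coprime (2 ^ i * 3 ^ j :: int) (int p)"
proof -
  have "coprime 2 p" "coprime 3 p"
    using assms by (intro primes_coprime; simp)+
  then have "coprime (int 2) (int p)" "coprime (int 3) (int p)"
    by (simp_all only: coprime_int_iff)
  then show ?thesis by simp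
qed

theorem theorem1p4:
  fixes p :: nat and a :: "nat \<Rightarrow> (nat \<Rightarrow> int)"
  assumes "prime p" and "p > 3"
    and "\<And>n. a n \<in> carrier (padic_int p)"
  shows "padic_cong p (int p ^ 2)
      (\<Oplus>\<^bsub>padic_int p\<^esub> k \<in> {0..p-1}.
        padic_frac p (int (((3*k) choose k) * ((2*k) choose k))) (27 ^ k)
          \<otimes>\<^bsub>padic_int p\<^esub> a k)
      (padic_of_int p (Legendre (int p) 3) \<otimes>\<^bsub>padic_int p\<^esub>
        (\<Oplus>\<^bsub>padic_int p\<^esub> k \<in> {0..p-1}.
          padic_frac p (int (((3*k) choose k) * ((2*k) choose k))) (27 ^ k)
            \<otimes>\<^bsub>padic_int p\<^esub> dual_seq p a k))
    \<and> padic_cong p (int p ^ 2)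
      (\<Oplus>\<^bsub>padic_int p\<^esub> k \<in> {0..p-1}.
        padic_frac p (int (((4*k) choose (2*k)) * ((2*k) choose k))) (64 ^ k)
          \<otimes>\<^bsub>padic_int p\<^esub> a k)
      (padic_of_int p (Legendre (-2) (int p)) \<otimes>\<^bsub>padic_int p\<^esub>
        (\<Oplus>\<^bsub>padic_int p\<^esub> k \<in> {0..p-1}.
          padic_frac p (int (((4*k) choose (2*k)) * ((2*k) choose k))) (64 ^ k)
            \<otimes>\<^bsub>padic_int p\<^esub> dual_seq p a k))
    \<and> padic_cong p (int p ^ 2)
      (\<Oplus>\<^bsub>padic_int p\<^esub> k \<in> {0..p-1}.
        padic_frac p (int (((6*k) choose (3*k)) * ((3*k) choose k))) (432 ^ k)
          \<otimes>\<^bsub>padic_int p\<^esub> a k)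
      (padic_of_int p (Legendre (-1) (int p)) \<otimes>\<^bsub>padic_int p\<^esub>
        (\<Oplus>\<^bsub>padic_int p\<^esub> k \<in> {0..p-1}.
          padic_frac p (int (((6*k) choose (3*k)) * ((3*k) choose k))) (432 ^ k)
            \<otimes>\<^bsub>padic_int p\<^esub> dual_seq p a k))"
proof (intro conjI)
  have odd: "odd p"
    using assms prime_odd_nat[of p] by auto
  have "\<not> 3 dvd p"
    using assms primes_dvd_imp_eq[of 3 p] by auto
  with odd have "\<exists>r. p = 6 * r + 1 \<or> p = 6 * r + 5"
    by presburger
  then obtain r where r: "p = 6 * r + 1 \<or> p = 6 * r + 5" ..
  have s3: "(-1) ^ n = Legendre (int p) 3" if n: "n < p" "[3 * int n = - 1] (mod int p)" for n
  proof -
    obtain q where q: "3 * n + 1 = p * q" "0 < q" "q < 3"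
      using inverse_residue_quotient[of n p 3] n by auto
    then have "q = 1 \<or> q = 2"
      by auto
    \<comment> \<open>Modulo 3 the equation makes q the inverse of p: q = 1 in the first case and q
      = 2 in the second.\<close>
    with q(1) r have "p = 6 * r + 1 \<and> n = 2 * r \<or> p = 6 * r + 5 \<and> n = 4 * r + 3"
      by (elim disjE) (simp_all, arith+)
    then have "int p mod 3 = 1 \<and> even n \<or> int p mod 3 = 2 \<and> odd n"
      by (elim disjE) (simp_all, presburger+)
    then show ?thesis
      by (auto simp: Legendre_mod_3)
  qed
  have s4: "(-1) ^ n = Legendre (- 2) (int p)" if n: "n < p" "[4 * int n = - 1] (mod int p)" for n
  proof -
    obtain q where q: "4 * n + 1 = p * q" "0 < q" "q < 4"
      using inverse_residue_quotient[of n p 4] n by auto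
    then have "q = 1 \<or> q = 2 \<or> q = 3"
      by auto
    moreover have "\<exists>u. p = 4 * u + 1 \<or> p = 4 * u + 3"
      using odd by presburger
    then obtain u where "p = 4 * u + 1 \<or> p = 4 * u + 3" ..
    \<comment> \<open>Here q is the inverse of p modulo 4, hence 1 or 3; in both cases n has the
      parity of u.\<close>
    ultimately have "p = 4 * u + 1 \<and> n = u \<or> p = 4 * u + 3 \<and> n = 3 * u + 2"
      using q(1) by (elim disjE) (simp_all, arith+)
    moreover from this have "(p - 1) div 4 = u"
      by arith
    ultimately have "even n \<longleftrightarrow> even ((p - 1) div 4)"
      by auto
    then show ?thesis
      using assms Legendre_minus_2[of p] by (simp add: minus_one_power_iff)
  qed
  have s6: "(-1) ^ n = Legendre (- 1) (int p)" if n: "n < p" "[6 * int n = - 1] (mod int p)" for n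
  proof -
    obtain q where q: "6 * n + 1 = p * q" "0 < q" "q < 6"
      using inverse_residue_quotient[of n p 6] n by auto
    then have "q = 1 \<or> q = 2 \<or> q = 3 \<or> q = 4 \<or> q = 5"
      by auto
    \<comment> \<open>Here q is the inverse of p modulo 6, hence 1 or 5; both n and (p - 1)/2 have
      the parity of r.\<close>
    with q(1) r have "p = 6 * r + 1 \<and> n = r \<or> p = 6 * r + 5 \<and> n = 5 * r + 4"
      by (elim disjE) (simp_all, arith+)
    then have "even n \<longleftrightarrow> even ((p - 1) div 2)"
      by auto
    then show ?thesis
      using assms Legendre_minus_1[of p] by (simp add: minus_one_power_iff)
  qed
  show "padic_cong p (int p ^ 2)
      (\<Oplus>\<^bsub>padic_int p\<^esub> k \<in> {0..p-1}.
        padic_frac p (int (((3*k) choose k) * ((2*k) choose k))) (27 ^ k)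
          \<otimes>\<^bsub>padic_int p\<^esub> a k)
      (padic_of_int p (Legendre (int p) 3) \<otimes>\<^bsub>padic_int p\<^esub>
        (\<Oplus>\<^bsub>padic_int p\<^esub> k \<in> {0..p-1}.
          padic_frac p (int (((3*k) choose k) * ((2*k) choose k))) (27 ^ k)
            \<otimes>\<^bsub>padic_int p\<^esub> dual_seq p a k))"
    using dual_sum_padic_cong[OF assms(1) odd assms(3) _ binomial_3_product s3]
      coprime_prime_3_smooth[OF assms(1,2), of 0 3] by simp
  show "padic_cong p (int p ^ 2)
      (\<Oplus>\<^bsub>padic_int p\<^esub> k \<in> {0..p-1}.
        padic_frac p (int (((4*k) choose (2*k)) * ((2*k) choose k))) (64 ^ k)
          \<otimes>\<^bsub>padic_int p\<^esub> a k)
      (padic_of_int p (Legendre (-2) (int p)) \<otimes>\<^bsub>padic_int p\<^esub>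
        (\<Oplus>\<^bsub>padic_int p\<^esub> k \<in> {0..p-1}.
          padic_frac p (int (((4*k) choose (2*k)) * ((2*k) choose k))) (64 ^ k)
            \<otimes>\<^bsub>padic_int p\<^esub> dual_seq p a k))"
    using dual_sum_padic_cong[OF assms(1) odd assms(3) _ binomial_4_product s4]
      coprime_prime_3_smooth[OF assms(1,2), of 6 0] by simp
  show "padic_cong p (int p ^ 2)
      (\<Oplus>\<^bsub>padic_int p\<^esub> k \<in> {0..p-1}.
        padic_frac p (int (((6*k) choose (3*k)) * ((3*k) choose k))) (432 ^ k)
          \<otimes>\<^bsub>padic_int p\<^esub> a k)
      (padic_of_int p (Legendre (-1) (int p)) \<otimes>\<^bsub>padic_int p\<^esub>
        (\<Oplus>\<^bsub>padic_int p\<^esub> k \<in> {0..p-1}.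
          padic_frac p (int (((6*k) choose (3*k)) * ((3*k) choose k))) (432 ^ k)
            \<otimes>\<^bsub>padic_int p\<^esub> dual_seq p a k))"
    using dual_sum_padic_cong[OF assms(1) odd assms(3) _ binomial_6_product s6]
      coprime_prime_3_smooth[OF assms(1,2), of 4 3] by simp
qed

end
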